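(* Let $C$ be a relative of the Hermitian curve of degree $\sqrt{q}+1$ over $\mathbb{F}_q$. Then the number $N_q(C)$ of $\mathbb{F}_q$-points of $C$ satisfies \[ N_q(C) \equiv 1 \mod \sqrt{q}. \] In particular, the set $C(\mathbb{F}_q)$ of $\mathbb{F}_q$-points of $C$ is not empty.
   Context: Throughout, $q$ is an even power of a prime number $p$, so $\sqrt{q}$ is also a power of $p$. For $A \in GL(3,\mathbb{F}_q)$, $C_A \subset \mathbb{P}^2$ denotes the (nonsingular) plane curve over $\mathbb{F}_q$ of degree $\sqrt{q}+1$ defined by $(x^{\sqrt{q}}, y^{\sqrt{q}}, z^{\sqrt{q}})\, A\, {}^t(x,y,z)=0$; it depends only on the image of $A$ in $PGL(3,\mathbb{F}_q)$. A relative of the Hermitian curve of degree $\sqrt{q}+1$ over $\mathbb{F}_q$ (Hermitian-relative curve) is a curve of the form $C_A$ with $A\in GL(3,\mathbb{F}_q)$. $C(\mathbb{F}_q)$ is the set of $\mathbb{F}_q$-points of $C$ in $\mathbb{P}^2$, and $N_q(C)$ is its cardinality. *)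

theory Defs
  imports "HOL-Analysis.Determinants" "HOL-Algebra.Algebraic_Closure_Type" "HOL-Number_Theory.Cong"
begin

definition proportional :: "(('k::field ^ 3) \<times> ('k ^ 3)) set" where
  "proportional = {(v, w). v \<noteq> 0 \<and> w \<noteq> 0 \<and> (\<exists>c. c \<noteq> 0 \<and> w = c *s v)}"

lemma equiv_proportional: "equiv {v :: 'k::field ^ 3. v \<noteq> 0} proportional"
proof (rule equivI)
  show "proportional \<subseteq> {v :: 'k ^ 3. v \<noteq> 0} \<times> {v. v \<noteq> 0}"
    by (auto simp: proportional_def)
  show "refl_on {v :: 'k ^ 3. v \<noteq> 0} proportional"
    by (auto simp: refl_on_def proportional_def intro!: exI[of _ 1])
  show "sym (proportional :: (('k ^ 3) \<times> ('k ^ 3)) set)"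
  proof (rule symI)
    fix v w :: "'k ^ 3" assume "(v, w) \<in> proportional"
    then obtain c where "v \<noteq> 0" "w \<noteq> 0" "c \<noteq> 0" "w = c *s v"
      by (auto simp: proportional_def)
    then show "(w, v) \<in> proportional"
      by (auto simp: proportional_def vector_smult_assoc intro!: exI[of _ "inverse c"])
  qed
  show "trans (proportional :: (('k ^ 3) \<times> ('k ^ 3)) set)"
  proof (rule transI)
    fix u v w :: "'k ^ 3" assume "(u, v) \<in> proportional" "(v, w) \<in> proportional"
    then obtain c d where "u \<noteq> 0" "w \<noteq> 0" "c \<noteq> 0" "v = c *s u" "d \<noteq> 0" "w = d *s v"
      by (auto simp: proportional_def)
    then show "(u, w) \<in> proportional"
      by (auto simp: proportional_def vector_smult_assoc intro!: exI[of _ "d * c"])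
  qed
qed

definition projective_plane :: "('k::field ^ 3) set set" where
  "projective_plane = {v. v \<noteq> 0} // proportional"

text \<open>
  Curves over a field \<open>'a\<close> are given by their points over the algebraic closure of \<open>'a\<close>.
  The parameter \<open>s\<close> below stands for the square root of the cardinality of \<open>'a\<close>.
\<close>

definition hermitian_form :: "nat \<Rightarrow> 'a::field ^ 3 ^ 3 \<Rightarrow> 'a alg_closure ^ 3 \<Rightarrow> 'a alg_closure" where
  "hermitian_form s A v = (\<Sum>i\<in>UNIV. \<Sum>j\<in>UNIV. (v $ i) ^ s * to_ac (A $ i $ j) * v $ j)"

text \<open>
  The form is homogeneous of degree \<open>s + 1\<close>, so its vanishing at \<open>P\<close> does not depend on the
  representative.
\<close>

definition hermitian_curve :: "nat \<Rightarrow> 'a::field ^ 3 ^ 3 \<Rightarrow> ('a alg_closure ^ 3) set set" where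
  "hermitian_curve s A = {P \<in> projective_plane. \<forall>v\<in>P. hermitian_form s A v = 0}"

definition hermitian_relative :: "nat \<Rightarrow> ('a::field alg_closure ^ 3) set set \<Rightarrow> bool" where
  "hermitian_relative s C \<longleftrightarrow> (\<exists>A :: 'a ^ 3 ^ 3. invertible A \<and> C = hermitian_curve s A)"

definition rational_points :: "('a::field alg_closure ^ 3) set set \<Rightarrow> ('a alg_closure ^ 3) set set" where
  "rational_points C = {P \<in> C. \<exists>v :: 'a ^ 3. (\<chi> i. to_ac (v $ i)) \<in> P}"

end

theory Submission imports Defs "HOL-Number_Theory.Residues" begin

text \<open>
  Write \<open>q = s\<^sup>2\<close> for the number of elements of the field \<open>F\<close> and \<open>f(v) = b(v, v)\<close> for the form that
  defines the curve, where \<open>b\<close> is linear in its second argument and \<open>s\<close>-semilinear in its first.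
  The nonzero zeros of \<open>f\<close> in \<open>F\<^sup>3\<close> fall into classes of \<open>q - 1\<close> proportional vectors, one class for
  each rational point. If \<open>Z\<close> is the number of zeros and \<open>N\<close> the number of rational points, then
  \<open>Z = 1 + N (q - 1)\<close>, which is congruent to \<open>1 - N\<close> modulo \<open>s\<close>. So the congruence says that \<open>s\<close>
  divides \<open>Z\<close> (\<open>sesquilinear_zeros_dvd\<close>); and \<open>N = 0\<close> is then impossible because \<open>s > 1\<close>.

  The form \<open>f\<close> need not be Hermitian, but it is controlled by Hermitian forms. Let \<open>Tr(x) = x + x\<^sup>s\<close> be the
  trace to the subfield of order \<open>s\<close>. For every scalar \<open>c\<close> the function \<open>Tr(c f(v))\<close> is the Hermitian
  form attached to \<open>c A\<close> plus its conjugate transpose. Count the pairs \<open>(c, v)\<close> with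
  \<open>Tr(c f(v)) = 0\<close>. A zero \<open>v\<close> of \<open>f\<close> occurs with all \<open>q\<close> scalars, any other \<open>v\<close> with exactly \<open>s\<close> of
  them, so there are \<open>s q\<^sup>3 + s (s - 1) Z\<close> pairs. If each Hermitian form has a number of
  zeros divisible by \<open>s\<^sup>2\<close>, it follows that \<open>s\<close> divides \<open>(s - 1) Z\<close>, hence \<open>Z\<close>.

  That a Hermitian form \<open>B\<close> in at least three variables has a number of zeros divisible by \<open>q\<close>
  (\<open>hermitian_zeros_dvd\<close>) holds whatever its rank, and is seen on the lines in the direction of one
  isotropic vector \<open>u\<close>. Such a \<open>u\<close> exists because the norm \<open>t \<mapsto> t\<^bsup>s+1\<^esup>\<close> maps onto the subfield. As
  \<open>B(w + t u, w + t u) = B(w, w) + Tr(t B(w, u))\<close>, a line through a vector orthogonal to \<open>u\<close> contains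
  \<open>0\<close> or \<open>q\<close> zeros, and every other line contains exactly \<open>s\<close>. The lines of the second kind
  fill the complement of a hyperplane or do not occur at all, so their number is a multiple of \<open>q\<close>.
\<close>

text \<open>The symbol \<open>$\<close> would also be read as a coefficient of a power series; here it selects a coordinate of a vector.\<close>

no_notation fps_nth (infixl \<open>$\<close> 75)

section \<open>Counting fibres, lines and roots\<close>

lemma card_eq_sum_fibres:
  assumes "finite S" "finite Y" "g ` S \<subseteq> Y"
  shows "card S = (\<Sum>y\<in>Y. card {x \<in> S. g x = y})"
  using sum.group[OF assms, of "\<lambda>_. 1::nat"] by simp

text \<open>
  A pigeonhole argument: upper bounds on the fibres and on the target that are only just
  compatible with the size of the source are both attained. For the trace and the norm the upper
  bounds come from counting roots of polynomials, and this lemma turns them into exact values and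
  into surjectivity.
\<close>

lemma card_fibre_eqI:
  assumes "finite S" "finite Y" "g ` S \<subseteq> Y"
    and le: "\<And>y. y \<in> Y \<Longrightarrow> card {x \<in> S. g x = y} \<le> k"
    and "card Y \<le> l" "card S = k * l" "y \<in> Y"
  shows "card {x \<in> S. g x = y} = k"
proof (rule ccontr)
  assume "card {x \<in> S. g x = y} \<noteq> k"
  then have "card {x \<in> S. g x = y} < k"
    using le[OF \<open>y \<in> Y\<close>] by simp
  then have "(\<Sum>y\<in>Y. card {x \<in> S. g x = y}) < (\<Sum>y\<in>Y. k)"
    using le \<open>y \<in> Y\<close> \<open>finite Y\<close> by (intro sum_strict_mono_ex1) auto
  also have "\<dots> \<le> k * l"
    using \<open>card Y \<le> l\<close> by simp
  finally show False
    using card_eq_sum_fibres[OF assms(1-3)] \<open>card S = k * l\<close> by simp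
qed

lemma sum_card_swap:
  "(\<Sum>x\<in>UNIV. card {y. P x y}) = (\<Sum>y\<in>UNIV. card {x. P x y})"
  for P :: "'a::finite \<Rightarrow> 'b::finite \<Rightarrow> bool"
proof -
  have "(\<Sum>x\<in>UNIV. card {y. P x y}) = (\<Sum>x\<in>UNIV. \<Sum>y\<in>UNIV. if P x y then 1 else 0)"
    by (simp flip: sum.inter_filter)
  also have "\<dots> = (\<Sum>y\<in>UNIV. \<Sum>x\<in>UNIV. if P x y then 1 else 0)"
    by (rule sum.swap)
  also have "\<dots> = (\<Sum>y\<in>UNIV. card {x. P x y})"
    by (simp flip: sum.inter_filter)
  finally show ?thesis .
qed

text \<open>
  The hyperplane \<open>w $ k = 0\<close> meets each line with direction \<open>u\<close> in exactly one point, which serves as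
  base point of the line.
\<close>

lemma card_eq_sum_lines:
  fixes u :: "'a::{field,finite} ^ 'n"
  assumes "u $ k \<noteq> 0"
  shows "card {v. P v} = (\<Sum>w | w $ k = 0. card {t. P (w + t *s u)})"
proof -
  define g where "g v = v + (- (v $ k / u $ k)) *s u" for v
  have "card {v. P v} = (\<Sum>w | w $ k = 0. card {v \<in> {v. P v}. g v = w})"
    using assms by (intro card_eq_sum_fibres) (auto simp: g_def)
  also have "\<dots> = (\<Sum>w | w $ k = 0. card {t. P (w + t *s u)})"
  proof (rule sum.cong)
    fix w assume "w \<in> {w :: 'a ^ 'n. w $ k = 0}"
    then have w: "w $ k = 0" by simp
    have g_eq: "g v + (v $ k / u $ k) *s u = v" for v
      by (simp add: g_def vec_eq_iff)
    have "bij_betw (\<lambda>t. w + t *s u) {t. P (w + t *s u)} {v \<in> {v. P v}. g v = w}"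
    proof (rule bij_betw_byWitness[where f' = "\<lambda>v. v $ k / u $ k"])
      show "\<forall>v\<in>{v \<in> {v. P v}. g v = w}. w + (v $ k / u $ k) *s u = v"
        using g_eq by auto
      then show "(\<lambda>v. v $ k / u $ k) ` {v \<in> {v. P v}. g v = w} \<subseteq> {t. P (w + t *s u)}"
        by auto
    qed (use assms w in \<open>auto simp: g_def vec_eq_iff\<close>)
    then show "card {v \<in> {v. P v}. g v = w} = card {t. P (w + t *s u)}"
      by (simp add: bij_betw_same_card)
  qed simp
  finally show ?thesis .
qed

lemma card_coordinate_hyperplane:
  "CARD('a) * card {v :: 'a::{field,finite} ^ 'n. v $ k = 0} = CARD('a) ^ CARD('n)"
  using card_eq_sum_lines[of "axis k 1 :: 'a ^ 'n" k "\<lambda>_. True"] by (simp add: axis_def mult.commute)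

text \<open>
  The kernel of a nonzero functional and a coordinate hyperplane have the same number of elements:
  both meet each line in the direction of \<open>x\<close> exactly once, if \<open>x\<close> lies in neither.
\<close>

lemma card_functional_zeros:
  fixes l :: "'a::{field,finite} ^ 'n \<Rightarrow> 'a"
  assumes "\<And>v w. l (v + w) = l v + l w" "\<And>c v. l (c *s v) = c * l v" "l x \<noteq> 0"
  shows "CARD('a) * card {v. l v = 0} = CARD('a) ^ CARD('n)"
proof -
  have "l 0 = 0" using assms(2)[of 0 0] by simp
  then have "x \<noteq> 0" using assms(3) by auto
  then obtain k where k: "x $ k \<noteq> 0" by (auto simp: vec_eq_iff)
  have "{t. l w + t * l x = 0} = {- l w / l x}" for w
    using assms(3) by (auto simp: field_simps eq_neg_iff_add_eq_0)
  then have "card {v. l v = 0} = card {v :: 'a ^ 'n. v $ k = 0}"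
    by (subst card_eq_sum_lines[OF k]) (simp add: assms)
  then show ?thesis by (simp add: card_coordinate_hyperplane)
qed

text \<open>
  The cases \<open>a = 1\<close>, \<open>a = 0\<close> and \<open>a = - 1\<close> bound the fibres of the trace, the fibres of the norm and
  the order of the subfield of fixed points of the \<open>s\<close>-th power.
\<close>

lemma card_trinomial_roots_le:
  fixes a r :: "'a::idom"
  assumes "n \<ge> 2"
  shows "card {x. x ^ n + a * x = r} \<le> n"
proof -
  define p where "p = monom 1 n + [:- r, a:]"
  have deg: "degree p = n"
    unfolding p_def using assms
    by (subst degree_add_eq_left) (auto simp: degree_monom_eq intro: le_less_trans[OF degree_pCons_le])
  then have "p \<noteq> 0" using assms by auto
  have "{x. x ^ n + a * x = r} = {x. poly p x = 0}"
    by (auto simp: p_def poly_monom algebra_simps)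
  then show ?thesis using card_poly_roots_bound[OF \<open>p \<noteq> 0\<close>] deg by simp
qed

section \<open>Trace and norm of a quadratic extension\<close>

text \<open>Multiplication by \<open>x\<close> permutes the nonzero elements, so it does not change their product.\<close>

lemma power_CARD_eq_self:
  fixes x :: "'a::{field,finite}"
  shows "x ^ CARD('a) = x"
proof (cases "x = 0")
  case False
  have "(\<Prod>y\<in>UNIV-{0}. x * y) = (\<Prod>y\<in>UNIV-{0}. y)"
    by (rule prod.reindex_bij_witness[of _ "\<lambda>y. y / x" "\<lambda>y. x * y"]) (use False in auto)
  then have "x ^ (CARD('a) - 1) = 1"
    by (simp add: prod.distrib)
  then have "x * x ^ (CARD('a) - 1) = x"
    by simp
  then show ?thesis
    by (simp flip: power_Suc)
qed (simp add: finite_UNIV_card_ge_0)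

definition sesquilinear :: "nat \<Rightarrow> ('a::field ^ 'n \<Rightarrow> 'a ^ 'n \<Rightarrow> 'a) \<Rightarrow> bool" where
  "sesquilinear s b \<longleftrightarrow>
    (\<forall>u v w. b (u + v) w = b u w + b v w) \<and> (\<forall>u v w. b u (v + w) = b u v + b u w) \<and>
    (\<forall>c v w. b (c *s v) w = c ^ s * b v w) \<and> (\<forall>c v w. b v (c *s w) = c * b v w)"

text \<open>
  The two assumptions make \<open>x \<mapsto> x\<^sup>s\<close> an automorphism of order at most two, which plays the role of
  complex conjugation. An element of the subfield of order \<open>s\<close> is expressed as one with \<open>r\<^sup>s = r\<close>.
\<close>

context
  fixes s :: nat
  assumes card_field: "CARD('a::{field,finite}) = s\<^sup>2"
    and add_power: "\<And>x y :: 'a. (x + y) ^ s = x ^ s + y ^ s"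
begin

lemma s_ge_2: "s \<ge> 2"
proof -
  have "card {0, 1 :: 'a} \<le> CARD('a)" by (rule card_mono) auto
  then have "2 \<le> s\<^sup>2" by (simp add: card_field)
  then show ?thesis
    by (cases "s = 0 \<or> s = 1") auto
qed

lemma power_power_self: "(x ^ s) ^ s = (x :: 'a)"
  using power_CARD_eq_self[of x] by (simp add: card_field power2_eq_square power_mult)

lemma zero_power_s: "0 ^ s = (0 :: 'a)"
  using s_ge_2 by simp

lemma minus_power_s: "(- x) ^ s = - (x ^ s)" for x :: 'a
  using add_power[of x "- x"] by (simp add: zero_power_s minus_equation_iff add_eq_0_iff)

lemma card_fixed_le: "card {y :: 'a. y ^ s = y} \<le> s"
  using card_trinomial_roots_le[of s "-1 :: 'a" 0] s_ge_2 by simp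

text \<open>
  The trace maps \<open>s\<^sup>2\<close> elements to at most \<open>s\<close> fixed points, with at most \<open>s\<close> elements in each fibre.
\<close>

lemma card_trace_fibre:
  fixes r :: 'a
  assumes "r ^ s = r"
  shows "card {t. t + t ^ s = r} = s"
proof -
  have "card {t \<in> UNIV. t + t ^ s = r} = s"
  proof (rule card_fibre_eqI)
    show "(\<lambda>t :: 'a. t + t ^ s) ` UNIV \<subseteq> {y. y ^ s = y}"
      by (auto simp: add_power power_power_self)
    show "card {t \<in> UNIV. t + t ^ s = y} \<le> s" for y :: 'a
      using card_trinomial_roots_le[of s 1 y] s_ge_2 by (simp add: add.commute)
  qed (use assms card_fixed_le in \<open>auto simp: card_field power2_eq_square\<close>)
  then show ?thesis by simp
qed

lemma card_scaled_trace_fibre: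
  fixes r b :: 'a
  assumes "r ^ s = r" "b \<noteq> 0"
  shows "card {t. t * b + (t * b) ^ s = r} = s"
proof -
  have "bij_betw (\<lambda>t. t * b) {t. t * b + (t * b) ^ s = r} {t. t + t ^ s = r}"
    by (rule bij_betw_byWitness[where f' = "\<lambda>t. t / b"]) (use assms in auto)
  then show ?thesis
    using card_trace_fibre[OF assms(1)] by (simp add: bij_betw_same_card)
qed

text \<open>
  The norm maps \<open>s\<^sup>2 - 1 = (s + 1) (s - 1)\<close> nonzero elements to at most \<open>s - 1\<close> nonzero fixed points,
  with at most \<open>s + 1\<close> elements in each fibre; so no fibre is empty.
\<close>

lemma norm_surjective:
  fixes r :: 'a
  assumes "r ^ s = r"
  shows "\<exists>t. t ^ Suc s = r"
proof (cases "r = 0")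
  case False
  have "card {t \<in> UNIV - {0}. t ^ Suc s = r} = Suc s"
  proof (rule card_fibre_eqI[where l = "s - 1" and Y = "{y. y ^ s = y} - {0}"])
    show "(\<lambda>t :: 'a. t ^ Suc s) ` (UNIV - {0}) \<subseteq> {y. y ^ s = y} - {0}"
      by (auto simp: power_mult_distrib power_power_self)
    show "card {t \<in> UNIV - {0}. t ^ Suc s = y} \<le> Suc s" for y :: 'a
    proof -
      have "card {t \<in> UNIV - {0}. t ^ Suc s = y} \<le> card {t. t ^ Suc s + 0 * t = y}"
        by (rule card_mono) auto
      then show ?thesis
        using card_trinomial_roots_le[of "Suc s" 0 y] s_ge_2 by linarith
    qed
    show "card (({y. y ^ s = y} :: 'a set) - {0}) \<le> s - 1"
      using card_fixed_le by (simp add: card_Diff_singleton_if zero_power_s)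
    have "CARD('a) - 1 = Suc s * (s - 1)"
      by (simp add: card_field power2_eq_square algebra_simps)
    then show "card (UNIV - {0 :: 'a}) = Suc s * (s - 1)"
      by (simp add: card_Diff_singleton_if)
  qed (use assms False in auto)
  then have "{t \<in> UNIV - {0}. t ^ Suc s = r} \<noteq> {}"
    by (metis card.empty nat.distinct(1))
  then show ?thesis by blast
qed (auto intro: exI[of _ 0])

section \<open>Zeros of sesquilinear forms\<close>

text \<open>
  For orthogonal vectors \<open>e\<close> and \<open>w\<close> the form takes the value \<open>B(e, e) + t\<^bsup>s+1\<^esup> B(w, w)\<close> at \<open>e + t w\<close>.
  Diagonal values lie in the subfield, so if neither \<open>e\<close> nor \<open>w\<close> is isotropic, then this can be made
  zero by the choice of a \<open>t\<close> with prescribed norm.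
\<close>

lemma hermitian_isotropic_vector:
  fixes B :: "'a ^ 'n \<Rightarrow> 'a ^ 'n \<Rightarrow> 'a"
  assumes "sesquilinear s B" and herm: "\<And>v w. B w v = (B v w) ^ s" and "CARD('n) \<ge> 2"
  shows "\<exists>u. u \<noteq> 0 \<and> B u u = 0"
proof -
  have add: "B (u + v) w = B u w + B v w" "B u (v + w) = B u v + B u w"
    and smult: "B (c *s v) w = c ^ s * B v w" "B v (c *s w) = c * B v w" for u v w c
    using assms(1) by (auto simp: sesquilinear_def)
  have "\<not> CARD('n) \<le> Suc 0"
    using \<open>CARD('n) \<ge> 2\<close> by simp
  then obtain i j :: 'n where "i \<noteq> j"
    using card_le_Suc0_iff_eq[of "UNIV :: 'n set"] by auto
  define e where "e = (axis i 1 :: 'a ^ 'n)"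
  \<comment> \<open>one Gram-Schmidt step, applied to the coordinate vectors \<open>i\<close> and \<open>j\<close>\<close>
  define w where "w = axis j 1 + (- (B e (axis j 1) / B e e)) *s e"
  show ?thesis
  proof (cases "B e e = 0")
    case True
    then show ?thesis by (intro exI[of _ e]) (simp add: e_def axis_eq_0_iff)
  next
    case False
    have "w $ j = 1"
      using \<open>i \<noteq> j\<close> by (simp add: w_def e_def axis_def)
    then have "w \<noteq> 0" by auto
    have "B e w = 0"
      using False by (simp only: w_def add smult) simp
    then have "B w e = 0"
      using herm[of e w] zero_power_s by simp
    show ?thesis
    proof (cases "B w w = 0")
      case True
      then show ?thesis using \<open>w \<noteq> 0\<close> by blast
    next
      case nz: False
      have "(- (B e e / B w w)) ^ s = - (B e e / B w w)"
        using herm[of e e] herm[of w w] by (simp add: minus_power_s power_divide)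
      then obtain t where t: "t ^ Suc s = - (B e e / B w w)"
        using norm_surjective by blast
      have "B e (e + t *s w) \<noteq> 0"
        using False \<open>B e w = 0\<close> by (simp add: add smult)
      moreover have "B e 0 = 0" using smult(2)[of e 0 0] by simp
      ultimately have "e + t *s w \<noteq> 0" by metis
      moreover have "B (e + t *s w) (e + t *s w) = B e e + t ^ Suc s * B w w"
        using \<open>B e w = 0\<close> \<open>B w e = 0\<close> by (simp add: add smult algebra_simps)
      ultimately show ?thesis using t nz by (intro exI[of _ "e + t *s w"]) simp
    qed
  qed
qed

text \<open>
  Three variables are needed: the lines that are not orthogonal to \<open>u\<close> contribute \<open>s\<close> zeros each, and
  if there are any, their number \<open>q\<^bsup>n-1\<^esup> - q\<^bsup>n-2\<^esup>\<close> is divisible by \<open>q\<close> only for \<open>n \<ge> 3\<close>.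
\<close>

lemma hermitian_zeros_dvd:
  fixes B :: "'a ^ 'n \<Rightarrow> 'a ^ 'n \<Rightarrow> 'a"
  assumes sesq: "sesquilinear s B" and herm: "\<And>v w. B w v = (B v w) ^ s" and n: "CARD('n) \<ge> 3"
  shows "s\<^sup>2 dvd card {v. B v v = 0}"
proof -
  have add: "B (u + v) w = B u w + B v w" "B u (v + w) = B u v + B u w"
    and smult: "B (c *s v) w = c ^ s * B v w" "B v (c *s w) = c * B v w" for u v w c
    using sesq by (auto simp: sesquilinear_def)
  obtain u where u: "u \<noteq> 0" "B u u = 0"
    using hermitian_isotropic_vector[OF sesq herm] n by auto
  then obtain k where k: "u $ k \<noteq> 0" by (auto simp: vec_eq_iff)
  define H where "H = {w :: 'a ^ 'n. w $ k = 0}"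
  define M where "M = {w \<in> H. B u w \<noteq> 0}"
  have on_line: "B (w + t *s u) (w + t *s u) = B w w + (t * B w u + (t * B w u) ^ s)" for w t
    using u herm[of w u] by (simp add: add smult power_mult_distrib
      power_power_self algebra_simps)
  have iff: "B w u = 0 \<longleftrightarrow> B u w = 0" for w
    using herm[of w u] herm[of u w] s_ge_2 by simp
  have line: "s\<^sup>2 dvd card {t. B (w + t *s u) (w + t *s u) = 0}" if "B u w = 0" for w
  proof (cases "B w w = 0")
    case True
    then show ?thesis
      using that iff[of w] zero_power_s by (simp add: on_line card_field)
  next
    case False
    then show ?thesis
      using that iff[of w] zero_power_s by (simp add: on_line card_field)
  qed
  have transversal: "card {t. B (w + t *s u) (w + t *s u) = 0} = s" if "B u w \<noteq> 0" for w
  proof -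
    have "(- B w w) ^ s = - B w w"
      using herm[of w w] by (simp add: minus_power_s)
    moreover have "B w u \<noteq> 0" using that iff by simp
    ultimately have "card {t. t * B w u + (t * B w u) ^ s = - B w w} = s"
      by (rule card_scaled_trace_fibre)
    then show ?thesis
      by (simp add: on_line add_eq_0_iff)
  qed
  \<comment> \<open>\<open>M\<close> indexes the lines outside the orthogonal hyperplane of \<open>u\<close>. That set is a union of such
      lines because \<open>u\<close> is isotropic, so counting its points counts the lines.\<close>
  have "s\<^sup>2 * card M = card {v. B u v \<noteq> 0}"
  proof -
    have "card {v. B u v \<noteq> 0} = (\<Sum>w\<in>H. card {t. B u (w + t *s u) \<noteq> 0})"
      unfolding H_def by (rule card_eq_sum_lines[OF k])
    also have "\<dots> = (\<Sum>w\<in>H. if B u w \<noteq> 0 then s\<^sup>2 else 0)"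
      using u by (intro sum.cong) (auto simp: add smult card_field)
    also have "\<dots> = s\<^sup>2 * card M"
      by (simp add: M_def H_def flip: sum.inter_filter)
    finally show ?thesis by simp
  qed
  moreover have "s\<^sup>2 * s\<^sup>2 dvd card {v. B u v \<noteq> 0}"
  proof (cases "\<exists>x. B u x \<noteq> 0")
    case True
    then obtain x where "B u x \<noteq> 0" by blast
    then have K: "s\<^sup>2 * card {v. B u v = 0} = (s\<^sup>2) ^ CARD('n)"
      using card_functional_zeros[of "B u" x] by (simp add: add smult card_field)
    define d where "d = CARD('n) - 3"
    have d: "CARD('n) = Suc (Suc (Suc d))"
      using n by (simp add: d_def)
    have "card {v. B u v = 0} = (s\<^sup>2) ^ Suc (Suc d)"
      using K s_ge_2 unfolding d power_Suc[of _ "Suc (Suc d)"] by (simp only: mult_cancel1) simp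
    moreover have "card {v. B u v \<noteq> 0} = (s\<^sup>2) ^ CARD('n) - card {v. B u v = 0}"
      using card_Diff_subset[of "{v. B u v = 0}" UNIV]
      by (simp add: card_field Compl_eq_Diff_UNIV[symmetric] Collect_neg_eq)
    ultimately have "card {v. B u v \<noteq> 0} = (s\<^sup>2 * s\<^sup>2) * ((s\<^sup>2) ^ Suc d - (s\<^sup>2) ^ d)"
      by (simp only: d diff_mult_distrib2 power_Suc mult.assoc)
    then show ?thesis by simp
  qed simp
  ultimately have "s\<^sup>2 * s\<^sup>2 dvd s\<^sup>2 * card M"
    by (simp only:)
  then have "s\<^sup>2 dvd card M"
    using s_ge_2 by (subst (asm) nat_mult_dvd_cancel1) auto
  have "card {v. B v v = 0} = (\<Sum>w\<in>H. card {t. B (w + t *s u) (w + t *s u) = 0})"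
    unfolding H_def by (rule card_eq_sum_lines[OF k])
  also have "\<dots> = (\<Sum>w\<in>M. card {t. B (w + t *s u) (w + t *s u) = 0}) +
      (\<Sum>w\<in>H - M. card {t. B (w + t *s u) (w + t *s u) = 0})"
    by (subst sum.subset_diff[of M H]) (auto simp: M_def)
  also have "(\<Sum>w\<in>M. card {t. B (w + t *s u) (w + t *s u) = 0}) = card M * s"
    by (simp add: M_def transversal)
  finally show ?thesis
    using \<open>s\<^sup>2 dvd card M\<close> by (auto intro!: dvd_add dvd_sum line simp: M_def)
qed

text \<open>
  Double counting of the pairs \<open>(c, v)\<close> for which the trace of \<open>c b(v, v)\<close> vanishes. With \<open>v\<close> fixed,
  their number distinguishes the zeros of the form from the other vectors; with \<open>c\<close> fixed, it is
  the number of zeros of the Hermitian form \<open>B c\<close>.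
\<close>

lemma sesquilinear_zeros_dvd:
  fixes b :: "'a ^ 'n \<Rightarrow> 'a ^ 'n \<Rightarrow> 'a"
  assumes sesq: "sesquilinear s b" and n: "CARD('n) \<ge> 3"
  shows "s dvd card {v. b v v = 0}"
proof -
  define Z where "Z = {v. b v v = 0}"
  have add: "b (u + v) w = b u w + b v w" "b u (v + w) = b u v + b u w"
    and smult: "b (c *s v) w = c ^ s * b v w" "b v (c *s w) = c * b v w" for u v w c
    using sesq by (auto simp: sesquilinear_def)
  define B where "B c v w = c * b v w + (c * b w v) ^ s" for c v w
  have "s\<^sup>2 dvd card {v. B c v v = 0}" for c
  proof (rule hermitian_zeros_dvd[where B = "B c", OF _ _ n])
    show "sesquilinear s (B c)"
      by (simp add: sesquilinear_def B_def add smult add_power power_mult_distrib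
          power_power_self algebra_simps)
    show "B c w v = (B c v w) ^ s" for v w
      by (simp add: B_def add_power power_power_self power_mult_distrib)
  qed
  then have dvd: "s\<^sup>2 dvd (\<Sum>c\<in>UNIV. card {v. B c v v = 0})"
    by (rule dvd_sum)
  have per_vector: "card {c. B c v v = 0} = s + (if v \<in> Z then s * (s - 1) else 0)" for v
  proof (cases "b v v = 0")
    case True
    then show ?thesis
      using s_ge_2 zero_power_s
      by (simp add: B_def Z_def card_field power2_eq_square algebra_simps)
  next
    case False
    then show ?thesis
      using card_scaled_trace_fibre[of 0 "b v v"] zero_power_s
      by (simp add: B_def Z_def)
  qed
  have "(\<Sum>c\<in>UNIV. card {v. B c v v = 0}) = (\<Sum>v\<in>UNIV. card {c. B c v v = 0})"
    by (rule sum_card_swap)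
  also have "\<dots> = CARD('a ^ 'n) * s + s * ((s - 1) * card Z)"
    by (simp only: per_vector sum.distrib) (simp flip: sum.inter_filter)
  finally have "s\<^sup>2 dvd CARD('a ^ 'n) * s + s * ((s - 1) * card Z)"
    using dvd by simp
  moreover have "s\<^sup>2 dvd CARD('a ^ 'n)"
    using n by (simp add: card_field)
  ultimately have "s * s dvd s * ((s - 1) * card Z)"
    by (simp add: dvd_add_right_iff power2_eq_square)
  then have "s dvd (s - 1) * card Z"
    using s_ge_2 by (subst (asm) nat_mult_dvd_cancel1) auto
  moreover have "coprime s (s - 1)"
    using s_ge_2 by (intro coprime_diff_one_right_nat) simp
  ultimately show ?thesis
    by (simp add: coprime_dvd_mult_right_iff Z_def)
qed

end

section \<open>Rational points\<close>

text \<open>The characteristic is a prime that divides the order of the field, hence it is \<open>p\<close>.\<close>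

lemma add_power_prime_power:
  fixes x y :: "'a::{field,finite}"
  assumes "prime p" "CARD('a) = p ^ n"
  shows "(x + y) ^ (p ^ m) = x ^ (p ^ m) + y ^ (p ^ m)"
proof -
  have prime: "prime CHAR('a)"
    by (simp add: prime_CHAR_semidom finite_imp_CHAR_pos)
  moreover have "CHAR('a) dvd p ^ n"
    using CHAR_dvd_CARD[where ?'a = 'a] assms(2) by simp
  ultimately have "CHAR('a) = p"
    using assms(1) prime prime_dvd_power primes_dvd_imp_eq by blast
  then show ?thesis
    using prime by (intro freshmans_dream') auto
qed

definition ac_vec :: "'a::field ^ 'n \<Rightarrow> 'a alg_closure ^ 'n" where
  "ac_vec v = (\<chi> i. to_ac (v $ i))"

lemma ac_vec_eq_0_iff: "ac_vec v = 0 \<longleftrightarrow> v = 0"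
  by (simp add: ac_vec_def vec_eq_iff)

definition sesq_form :: "nat \<Rightarrow> 'a::comm_semiring_1 ^ 'n ^ 'n \<Rightarrow> 'a ^ 'n \<Rightarrow> 'a ^ 'n \<Rightarrow> 'a" where
  "sesq_form s A v w = (\<Sum>i\<in>UNIV. \<Sum>j\<in>UNIV. (v $ i) ^ s * A $ i $ j * w $ j)"

lemma sesquilinear_sesq_form:
  fixes A :: "'a::field ^ 'n ^ 'n"
  assumes "\<And>x y :: 'a. (x + y) ^ s = x ^ s + y ^ s"
  shows "sesquilinear s (sesq_form s A)"
  by (simp add: sesquilinear_def sesq_form_def assms power_mult_distrib algebra_simps
      sum.distrib sum_distrib_left)

lemma sesq_form_smult: "sesq_form s A (c *s v) (c *s v) = c ^ Suc s * sesq_form s A v v"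
  by (simp add: sesq_form_def power_mult_distrib sum_distrib_left mult_ac)

lemma hermitian_form_ac_vec: "hermitian_form s A (ac_vec v) = to_ac (sesq_form s A v v)"
  by (simp add: hermitian_form_def ac_vec_def sesq_form_def to_ac_sum)

lemma hermitian_form_smult:
  "hermitian_form s A (c *s v) = c ^ Suc s * hermitian_form s A v"
  by (simp add: hermitian_form_def power_mult_distrib sum_distrib_left mult_ac)

lemma ac_vec_in_rational_class:
  assumes "(\<chi> i. to_ac (v $ i)) \<in> P" "P \<in> projective_plane"
  shows "v \<noteq> 0 \<and> P = proportional `` {ac_vec v}"
proof -
  obtain x where x: "P = proportional `` {x}" "x \<noteq> 0"
    using assms(2) by (auto simp: projective_plane_def quotient_def)
  have "(x, ac_vec v) \<in> proportional"
    using assms(1) x by (simp add: ac_vec_def)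
  then have "ac_vec v \<noteq> 0" "proportional `` {x} = proportional `` {ac_vec v}"
    using equiv_class_eq[OF equiv_proportional, of x "ac_vec v"] by (simp_all add: proportional_def)
  then show ?thesis
    using x by (simp add: ac_vec_eq_0_iff)
qed

lemma rational_points_hermitian_curve:
  "rational_points (hermitian_curve s A) =
    (\<lambda>v. proportional `` {ac_vec v}) ` {v. v \<noteq> 0 \<and> sesq_form s A v v = 0}"
  (is "?L = ?R")
proof (intro equalityI subsetI)
  fix P assume "P \<in> ?L"
  then obtain v where P: "P \<in> projective_plane" "\<forall>x\<in>P. hermitian_form s A x = 0"
    and v: "(\<chi> i. to_ac (v $ i)) \<in> P"
    by (auto simp: rational_points_def hermitian_curve_def)
  have "sesq_form s A v v = 0"
    using P(2) v hermitian_form_ac_vec[of s A v] by (simp add: ac_vec_def)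
  then show "P \<in> ?R"
    using ac_vec_in_rational_class[OF v P(1)] by auto
next
  fix P assume "P \<in> ?R"
  then obtain v where v: "v \<noteq> 0" "sesq_form s A v v = 0" and P: "P = proportional `` {ac_vec v}"
    by auto
  have "P \<in> projective_plane"
    using v by (simp add: P projective_plane_def quotientI ac_vec_eq_0_iff)
  moreover have "\<forall>x\<in>P. hermitian_form s A x = 0"
    using v by (auto simp: P proportional_def hermitian_form_smult hermitian_form_ac_vec)
  moreover have "ac_vec v \<in> P"
    using v equiv_class_self[OF equiv_proportional, of "ac_vec v"] by (simp add: P ac_vec_eq_0_iff)
  ultimately show "P \<in> ?L"
    by (auto simp: rational_points_def hermitian_curve_def ac_vec_def)
qed

text \<open>
  A factor between two rational vectors is a quotient of coordinates, so proportionality over the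
  algebraic closure already holds over the ground field. This is why a rational point has exactly
  \<open>q - 1\<close> rational representatives.
\<close>

lemma proportional_ac_vec_iff:
  assumes "v \<noteq> 0"
  shows "(ac_vec v, ac_vec w) \<in> proportional \<longleftrightarrow> (\<exists>c. c \<noteq> 0 \<and> w = c *s v)"
proof
  assume "(ac_vec v, ac_vec w) \<in> proportional"
  then obtain c where c: "c \<noteq> 0" "ac_vec w = c *s ac_vec v"
    by (auto simp: proportional_def)
  obtain k where k: "v $ k \<noteq> 0"
    using assms by (auto simp: vec_eq_iff)
  have comp: "to_ac (w $ i) = c * to_ac (v $ i)" for i
    using c(2) by (simp add: ac_vec_def vec_eq_iff)
  have "c = to_ac (w $ k / v $ k)"
    using comp[of k] k by simp
  then have comp': "w $ i = (w $ k / v $ k) * v $ i" for i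
    using comp[of i] by (simp only: \<open>c = to_ac (w $ k / v $ k)\<close> to_ac_mult[symmetric] to_ac_eq_iff)
  have "w = (w $ k / v $ k) *s v"
    unfolding vec_eq_iff vector_smult_component using comp' by blast
  moreover have "w $ k / v $ k \<noteq> 0"
    using c(1) \<open>c = to_ac (w $ k / v $ k)\<close> by (simp only: to_ac_eq_0_iff not_False_eq_True)
  ultimately show "\<exists>c. c \<noteq> 0 \<and> w = c *s v"
    by blast
next
  assume "\<exists>c. c \<noteq> 0 \<and> w = c *s v"
  then obtain c where c: "c \<noteq> 0" "w = c *s v" by blast
  then have "ac_vec w = to_ac c *s ac_vec v" "w \<noteq> 0"
    using assms by (auto simp: ac_vec_def vec_eq_iff)
  then show "(ac_vec v, ac_vec w) \<in> proportional"
    using assms c by (auto simp: proportional_def ac_vec_eq_0_iff intro!: exI[of _ "to_ac c"])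
qed

lemma card_rational_points:
  fixes A :: "'a::{field,finite} ^ 3 ^ 3"
  shows "card {v. sesq_form s A v v = 0} =
    Suc (card (rational_points (hermitian_curve s A)) * (CARD('a) - 1))"
proof -
  define Z where "Z = {v. v \<noteq> 0 \<and> sesq_form s A v v = 0}"
  define cls where "cls v = proportional `` {ac_vec v}" for v :: "'a ^ 3"
  have fibre: "card {w \<in> Z. cls w = cls v} = CARD('a) - 1" if "v \<in> Z" for v
  proof -
    have v: "v \<noteq> 0" "sesq_form s A v v = 0"
      using that by (auto simp: Z_def)
    have form: "sesq_form s A (c *s v) (c *s v) = 0" for c
      using v(2) by (simp add: sesq_form_smult)
    have "{w \<in> Z. cls w = cls v} = (\<lambda>c. c *s v) ` (UNIV - {0})"
    proof (rule Set.set_eqI)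
      fix w
      have "w \<in> {w \<in> Z. cls w = cls v} \<longleftrightarrow> w \<in> Z \<and> (ac_vec v, ac_vec w) \<in> proportional"
        using eq_equiv_class_iff[OF equiv_proportional, of "ac_vec v" "ac_vec w"] v
        by (auto simp: cls_def ac_vec_eq_0_iff Z_def)
      also have "\<dots> \<longleftrightarrow> w \<in> Z \<and> (\<exists>c. c \<noteq> 0 \<and> w = c *s v)"
        using proportional_ac_vec_iff v by blast
      also have "\<dots> \<longleftrightarrow> w \<in> (\<lambda>c. c *s v) ` (UNIV - {0})"
        using v form by (auto simp: Z_def)
      finally show "w \<in> {w \<in> Z. cls w = cls v} \<longleftrightarrow> w \<in> (\<lambda>c. c *s v) ` (UNIV - {0})" .
    qed
    moreover have "inj_on (\<lambda>c. c *s v) (UNIV - {0})"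
      using v by (auto simp: inj_on_def)
    ultimately show ?thesis
      by (simp add: card_image card_Diff_singleton_if)
  qed
  have "card Z = (\<Sum>P\<in>cls ` Z. card {w \<in> Z. cls w = P})"
    by (rule card_eq_sum_fibres) auto
  also have "\<dots> = card (cls ` Z) * (CARD('a) - 1)"
    using fibre by (subst sum.cong[where h = "\<lambda>_. CARD('a) - 1"]) auto
  also have "cls ` Z = rational_points (hermitian_curve s A)"
    by (simp add: rational_points_hermitian_curve Z_def cls_def)
  finally have "card Z = card (rational_points (hermitian_curve s A)) * (CARD('a) - 1)" .
  moreover have "sesq_form s A 0 0 = 0"
    by (simp add: sesq_form_def)
  then have "{v. sesq_form s A v v = 0} = insert 0 Z"
    by (auto simp: Z_def)
  ultimately show ?thesis
    by (simp add: Z_def)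
qed

theorem theorem2p3:
  fixes C :: "('a::{field,finite} alg_closure ^ 3) set set" and p m :: nat
  assumes "prime p" and "m > 0" and "CARD('a) = p ^ (2 * m)"
    and "hermitian_relative (p ^ m) C"
  shows "[card (rational_points C) = 1] (mod p ^ m) \<and> rational_points C \<noteq> {}"
proof -
  define s where "s = p ^ m"
  have card: "CARD('a) = s\<^sup>2"
    using assms(3) by (simp add: s_def power_mult mult.commute)
  have add: "(x + y) ^ s = x ^ s + y ^ s" for x y :: 'a
    unfolding s_def by (rule add_power_prime_power[OF assms(1,3)])
  obtain A :: "'a ^ 3 ^ 3" where C: "C = hermitian_curve s A"
    using assms(4) by (auto simp: hermitian_relative_def s_def)
  define N where "N = card (rational_points C)"
  have "s dvd card {v. sesq_form s A v v = 0}"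
    by (rule sesquilinear_zeros_dvd[where b = "sesq_form s A", OF card add sesquilinear_sesq_form[OF add]]) simp
  then have "s dvd Suc (N * (s\<^sup>2 - 1))"
    by (simp add: card_rational_points C N_def card)
  \<comment> \<open>Adding \<open>N\<close> avoids the truncated subtraction: \<open>Suc (N * (s\<^sup>2 - 1)) + N\<close> is \<open>1 + N s\<^sup>2\<close>.\<close>
  then have "[Suc (N * (s\<^sup>2 - 1)) + N = 0 + N] (mod s)"
    by (intro cong_add cong_refl) (simp add: cong_0_iff)
  moreover have "Suc (N * (s\<^sup>2 - 1)) + N = 1 + s * (s * N)"
    using s_ge_2[OF card add] by (cases s) (auto simp: power2_eq_square algebra_simps)
  moreover have "[1 + s * (s * N) = 1] (mod s)"
    unfolding cong_def by (rule mod_mult_self2)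
  ultimately have "[N = 1] (mod s)"
    by (simp only: add_0 cong_def)
  moreover from this have "N \<noteq> 0"
    using s_ge_2[OF card add] by (intro notI) (simp add: cong_def)
  ultimately show ?thesis
    unfolding N_def s_def by auto
qed

end
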